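(* Let $H$ be a connected hypergraph on $n$ vertices such that $|e|\ge r$ for all $e\in E(H)$. For all weight vectors $x$, the iterated averaging process converges to its average value $\overline{x}$ as follows: \[\mathbb{E}\left[\|R^t(x)-\overline{x}\|_2\right]\le e^{-c}\|x-\overline{x}\|_2\quad\text{whenever } t\ge 2c\cdot\frac{r|E(H)|}{\lambda_1(H)},\] \[\mathbb{E}\left[\|R^t(x)-\overline{x}\|_1\right]\le e^{-c}\|x-\overline{x}\|_2\quad\text{whenever } t\ge (\log(n)+2c)\cdot\frac{r|E(H)|}{\lambda_1(H)}.\]
   Context: A hypergraph $H$ is a set of vertices $V(H)$ together with a multiset $E(H)$ of subsets of $V(H)$, called edges; no restriction is placed on the multiplicity or size of any edge, and $|E(H)|$ counts edges with multiplicity. $H$ is connected if for every non-empty subset $S\subsetneq V(H)$ there is an edge $e\in E(H)$ containing a vertex in $S$ and a vertex in $V(H)\setminus S$. A weight vector of $H$ is a real-valued vector $x=(x_v)_{v\in V(H)}$. The random vector $R(x)$ is obtained by choosing an edge $e$ uniformly at random from $E(H)$ and setting $R(x)_u=x_u$ if $u\notin e$ and $R(x)_u=|e|^{-1}\sum_{v\in e}x_v$ if $u\in e$. Recursively, $R^1(x)=R(x)$ and $R^t(x)=R(R^{t-1}(x))$; equivalently, $R^t(x)$ is obtained by uniformly generating a sequence of $t$ edges and performing the averaging for each edge sequentially. The vector $\overline{x}$ has all coordinates equal to $\frac1n\sum_u x_u$. For $u\neq v$ the codegree $d(u,v)$ is the number of edges (with multiplicity) containing both $u$ and $v$. The codegree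 Laplacian $L(H)$ is the $n\times n$ real symmetric matrix with $L(H)_{u,v}=-d(u,v)$ for $u\ne v$ and $L(H)_{u,u}=\sum_{v\neq u}d(u,v)$. Its eigenvalues, with multiplicity, are $\lambda_0(H)\le\lambda_1(H)\le\cdots\le\lambda_{n-1}(H)$; for connected $H$ one has $\lambda_1(H)>0$. Here $c$ is a real parameter and $\log$ is the natural logarithm.
   Formalization: The hypothesis |e| ≥ r is replaced by |e| ≤ r for all edges e; with |e| ≥ r the claim fails, e.g. for edges {1,2,3}, {2,3} with r = 1, c = 3/4, t = 1, x = (2,-1,-1). *)

theory Defs
  imports "HOL-Probability.Probability" "HOL-Computational_Algebra.Polynomial"
begin

text \<open>The vertex set is the whole (finite, non-empty) type, so \<open>n = CARD('v)\<close>.  Edges of any size,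
  including the empty edge and singletons, and of any multiplicity are allowed;
  \<open>size H\<close> is the number of edges counted with multiplicity.\<close>

type_synonym 'v hypergraph = "'v set multiset"

definition connected_hypergraph :: "'v hypergraph \<Rightarrow> bool" where
  "connected_hypergraph H \<longleftrightarrow>
     (\<forall>S. S \<noteq> {} \<and> S \<subset> UNIV \<longrightarrow> (\<exists>e. e \<in># H \<and> e \<inter> S \<noteq> {} \<and> e \<inter> (UNIV - S) \<noteq> {}))"

definition average_edge :: "'v::finite set \<Rightarrow> real ^ 'v \<Rightarrow> real ^ 'v" where
  "average_edge e x = (\<chi> u. if u \<in> e then (\<Sum>v\<in>e. x $ v) / real (card e) else x $ u)"

text \<open>\<open>averaging_step H x\<close> is the law of \<open>R(x)\<close>, and \<open>averaging_process H t x\<close> the law of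
  \<open>R\<^sup>t(x)\<close>, where \<open>R\<^sup>0(x) = x\<close>.  The law of a uniform edge is meaningful only for \<open>H \<noteq> {#}\<close>; a connected
  hypergraph without edges has a single vertex.\<close>

definition averaging_step :: "'v::finite hypergraph \<Rightarrow> real ^ 'v \<Rightarrow> (real ^ 'v) pmf" where
  "averaging_step H x = map_pmf (\<lambda>e. average_edge e x) (pmf_of_multiset H)"

primrec averaging_process :: "'v::finite hypergraph \<Rightarrow> nat \<Rightarrow> real ^ 'v \<Rightarrow> (real ^ 'v) pmf" where
  "averaging_process H 0 x = return_pmf x"
| "averaging_process H (Suc t) x = bind_pmf (averaging_process H t x) (averaging_step H)"

definition average_vector :: "real ^ 'v::finite \<Rightarrow> real ^ 'v" where
  "average_vector x = (\<chi> u. (\<Sum>v\<in>UNIV. x $ v) / real CARD('v))"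

definition l1_norm :: "real ^ 'v::finite \<Rightarrow> real" where
  "l1_norm x = (\<Sum>u\<in>UNIV. \<bar>x $ u\<bar>)"

definition codegree :: "'v hypergraph \<Rightarrow> 'v \<Rightarrow> 'v \<Rightarrow> nat" where
  "codegree H u v = size {#e \<in># H. u \<in> e \<and> v \<in> e#}"

definition codegree_laplacian :: "'v::finite hypergraph \<Rightarrow> real ^ 'v ^ 'v" where
  "codegree_laplacian H =
     (\<chi> u v. if u = v then (\<Sum>w\<in>UNIV - {u}. real (codegree H u w)) else - real (codegree H u v))"

definition charpoly :: "real ^ 'v ^ 'v::finite \<Rightarrow> real poly" where
  "charpoly A = det ((\<chi> i j. (if i = j then [:0, 1:] else 0) - [:A $ i $ j:]) :: real poly ^ 'v ^ 'v)"

text \<open>For a real symmetric matrix the characteristic polynomial splits over the reals, so this list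
  has length \<open>n\<close>: it consists of the eigenvalues with multiplicity, in increasing order.\<close>

definition eigenvalue_list :: "real ^ 'v ^ 'v::finite \<Rightarrow> real list" where
  "eigenvalue_list A = sorted_list_of_multiset (proots (charpoly A))"

text \<open>\<open>laplacian_eigenvalue H i\<close> is \<open>\<lambda>\<^sub>i(H)\<close>, indexed from 0; it is meaningful only for \<open>i < n\<close>.\<close>

definition laplacian_eigenvalue :: "'v::finite hypergraph \<Rightarrow> nat \<Rightarrow> real" where
  "laplacian_eigenvalue H i = eigenvalue_list (codegree_laplacian H) ! i"

text \<open>The mixing bounds for the averaging process use an \<^emph>\<open>upper\<close> bound \<open>|e| \<le> r\<close> on the edge sizes, as
  \<open>E \<parallel>R(x) - x'\<parallel>\<^sup>2 = \<parallel>x - x'\<parallel>\<^sup>2 - (1/|E|) \<Sum>\<^sub>e (1/|e|) \<Sum>\<^bsub>{u,v} \<subseteq> e\<^esub> (x\<^sub>u - x\<^sub>v)\<^sup>2\<close>,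
  where \<open>x'\<close> is the average vector.  A lower bound \<open>|e| \<ge> r\<close> in its place would be wrong: for the edges
  \<open>{1,2,3}\<close>, \<open>{2,3}\<close> the eigenvalues are 0, 3, 5; with \<open>r = 1\<close>, \<open>c = 3/4\<close>, \<open>t = 1\<close> and
  \<open>x = (2,-1,-1)\<close> we have \<open>t = 2c r|E|/\<lambda>\<^sub>1\<close>, but \<open>E \<parallel>R(x)\<parallel> = \<parallel>x\<parallel>/2 > exp(-3/4) \<parallel>x\<parallel>\<close>.\<close>

end

theory Submission
  imports Defs
begin

text \<open>Averaging over \<open>e\<close> preserves the mean and lowers \<open>\<parallel>z\<parallel>\<^sup>2\<close>, for \<open>z\<close> the centred weight vector, by
  \<open>(1/|e|) \<Sum>\<^bsub>{u,v} \<subseteq> e\<^esub> (z\<^sub>u - z\<^sub>v)\<^sup>2\<close>.  Since \<open>|e| \<le> r\<close>, the mean decrease is at least \<open>z \<bullet> L z / (r|E|)\<close>, hence at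
  least \<open>\<lambda>\<^sub>1 \<parallel>z\<parallel>\<^sup>2 / (r|E|)\<close> as \<open>z\<close> is orthogonal to the constants, and \<open>E \<parallel>R\<^sup>t(x) - x'\<parallel>\<^sup>2\<close> decays like
  \<open>exp(- \<lambda>\<^sub>1 t / (r|E|))\<close>.  The two bounds follow by Jensen and Cauchy--Schwarz.

  The spectral theorem is not needed for the Rayleigh bound: a minimiser of the Rayleigh quotient on
  the orthogonal complement of the constants is an eigenvector, and connectedness makes 0 a simple
  root of the characteristic polynomial, so that \<open>\<lambda>\<^sub>1\<close> is the smallest nonzero root.\<close>

section \<open>Characteristic polynomials and their roots\<close>

lemma poly_det: "poly (det A) a = det (\<chi> i j. poly (A $ i $ j) a)"
  for A :: "'a::comm_ring_1 poly ^ 'n ^ 'n"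
  by (simp add: det_def poly_sum poly_prod)

lemma poly_charpoly: "poly (charpoly A) a = det (mat a - A)"
  unfolding charpoly_def poly_det
  by (rule arg_cong[where f = det]) (auto simp: vec_eq_iff mat_def)

lemma poly_charpoly_eq_0_iff:
  "poly (charpoly A) a = 0 \<longleftrightarrow> (\<exists>v. v \<noteq> 0 \<and> A *v v = a *\<^sub>R v)"
proof -
  have "mat a *v v = a *\<^sub>R v" for v :: "real ^ 'a"
    by (simp add: vec_eq_iff matrix_vector_mult_def mat_def mult_delta_left)
  then have "(mat a - A) *v v = a *\<^sub>R v - A *v v" for v
    by (simp add: matrix_vector_mult_diff_rdistrib)
  then show ?thesis
    using invertible_det_nz[of "mat a - A"] invertible_left_inverse[of "mat a - A"]
      matrix_left_invertible_ker[of "mat a - A"]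
    by (auto simp: poly_charpoly)
qed

text \<open>Adding all rows of \<open>X I - A\<close> to row \<open>k\<close> turns it into \<open>X (1, \<dots>, 1)\<close>.\<close>
lemma charpoly_zero_column_sums:
  fixes A :: "real ^ 'n ^ 'n"
  assumes "1 v* A = 0"
  obtains q where "charpoly A = [:0, 1:] * q"
    and "poly q 0 = det (\<chi> i. if i = k then 1 else row i (- A))"
proof
  define q where "q = det ((\<chi> i j. if i = k then 1 else (if i = j then [:0, 1:] else 0) - [:A $ i $ j:])
    :: real poly ^ 'n ^ 'n)"
  have q: "poly q a = det (\<chi> i. if i = k then 1 else row i (mat a - A))" for a
    unfolding q_def poly_det
    by (rule arg_cong[where f = det]) (auto simp: vec_eq_iff mat_def row_def)
  have "(\<Sum>i\<in>UNIV. A $ i $ j) = 0" for j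
    using assms by (simp add: vec_eq_iff vector_matrix_mult_def)
  then have rows: "(\<Sum>i\<in>UNIV. 1 $ i *s row i (mat a - A)) = a *s 1" for a
    by (simp add: vec_eq_iff row_def mat_def sum_subtractf)
  \<comment> \<open>The polynomial identity is checked at every real \<open>a\<close>, so the row
    operations take place over a field.\<close>
  have "poly (charpoly A) a = poly ([:0, 1:] * q) a" for a
  proof -
    have "det (mat a - A) = det (\<chi> i. if i = k then a *s 1 else row i (mat a - A))"
      using cramer_lemma_transpose[of k 1 "mat a - A"] unfolding rows by simp
    also have "\<dots> = a * poly q a"
      unfolding det_row_mul q ..
    finally show ?thesis
      by (simp add: poly_charpoly)
  qed
  then show "charpoly A = [:0, 1:] * q"
    by (simp add: poly_eq_poly_eq_iff[symmetric] fun_eq_iff)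
  show "poly q 0 = det (\<chi> i. if i = k then 1 else row i (- A))"
    unfolding q by (rule arg_cong[where f = det]) (simp add: vec_eq_iff mat_def row_def)
qed

section \<open>Minimising the Rayleigh quotient on a hyperplane\<close>

lemma symmetric_matrix_inner: "transpose A = A \<Longrightarrow> x \<bullet> (A *v y) = (A *v x) \<bullet> y"
  for A :: "real ^ 'n ^ 'n"
  by (metis dot_lmul_matrix transpose_matrix_vector)

text \<open>First-variation argument: near 0 the linear term dominates the quadratic one, so it must
  vanish at a minimum.\<close>

lemma nonneg_quadratic_imp_linear_zero:
  fixes b c :: real
  assumes "\<And>t. 0 \<le> 2 * t * b + t\<^sup>2 * c"
  shows "b = 0"
proof (rule ccontr)
  assume "b \<noteq> 0"
  define s where "s = \<bar>c\<bar> + 1"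
  then have "s > 0" "c \<le> s"
    by auto
  \<comment> \<open>\<open>- b / s\<close> minimises the quadratic once \<open>c\<close> is replaced
    by the positive upper bound \<open>s\<close>.\<close>
  have "2 * (- b / s) * b + (- b / s)\<^sup>2 * c \<le> 2 * (- b / s) * b + (- b / s)\<^sup>2 * s"
    using \<open>c \<le> s\<close> by (intro add_left_mono mult_left_mono) auto
  also have "\<dots> = - (b\<^sup>2 / s)"
    using \<open>s > 0\<close> by (simp add: power2_eq_square field_simps)
  also have "\<dots> < 0"
    using \<open>b \<noteq> 0\<close> \<open>s > 0\<close> by simp
  finally show False
    using assms[of "- b / s"] by simp
qed

text \<open>Compactness of the unit sphere in the hyperplane yields a minimiser; \<open>w\<close>
  shows that this set is non-empty. The first variation at the minimiser gives the eigenvector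
  equation.\<close>

lemma rayleigh_minimum_orthogonal:
  fixes A :: "real ^ 'n ^ 'n" and u :: "real ^ 'n"
  assumes sym: "transpose A = A" and ker: "A *v u = 0"
    and ex: "w \<noteq> 0" "u \<bullet> w = 0"
  obtains v \<mu> where "v \<noteq> 0" "u \<bullet> v = 0" "A *v v = \<mu> *\<^sub>R v"
    and "\<And>y. u \<bullet> y = 0 \<Longrightarrow> \<mu> * (norm y)\<^sup>2 \<le> y \<bullet> (A *v y)"
proof -
  define S where "S = sphere 0 1 \<inter> {y. u \<bullet> y = 0}"
  have "compact S"
    unfolding S_def by (intro compact_Int_closed compact_sphere closed_hyperplane)
  moreover have "w /\<^sub>R norm w \<in> S"
    using ex by (simp add: S_def)
  moreover have "continuous_on S (\<lambda>y. y \<bullet> (A *v y))"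
    by (intro continuous_intros linear_continuous_on matrix_vector_mul_bounded_linear)
  ultimately obtain v where v: "v \<in> S" and min: "\<And>y. y \<in> S \<Longrightarrow> v \<bullet> (A *v v) \<le> y \<bullet> (A *v y)"
    using continuous_attains_inf[of S "\<lambda>y. y \<bullet> (A *v y)"] by blast
  define \<mu> where "\<mu> = v \<bullet> (A *v v)"
  have bound: "\<mu> * (norm y)\<^sup>2 \<le> y \<bullet> (A *v y)" if "u \<bullet> y = 0" for y
  proof (cases "y = 0")
    case False
    then have "y /\<^sub>R norm y \<in> S"
      using that by (simp add: S_def)
    from min[OF this] have "\<mu> \<le> (y \<bullet> (A *v y)) / (norm y)\<^sup>2"
      by (simp add: \<mu>_def matrix_vector_mult_scaleR power2_eq_square field_simps)
    with False show ?thesis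
      by (simp add: field_simps)
  qed simp
  \<comment> \<open>The residual of the eigenvector equation serves as the direction of variation.
    It stays in the hyperplane because \<open>A\<close> is symmetric and kills
    \<open>u\<close>.\<close>
  define z where "z = A *v v - \<mu> *\<^sub>R v"
  have uv: "u \<bullet> v = 0" and nv: "v \<bullet> v = 1"
    using v by (auto simp: S_def norm_eq_1)
  have zv: "z \<bullet> (A *v v) = z \<bullet> z + \<mu> * (v \<bullet> z)"
    by (simp add: z_def inner_diff_right inner_diff_left inner_commute algebra_simps)
  have uz: "u \<bullet> z = 0"
    using uv ker by (simp add: z_def inner_diff_right symmetric_matrix_inner[OF sym])
  \<comment> \<open>This is \<open>bound\<close> at \<open>v + t *\<^sub>R z\<close>: the constants
    and the terms in \<open>v \<bullet> z\<close> cancel.\<close>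
  have "0 \<le> 2 * t * (z \<bullet> z) + t\<^sup>2 * (z \<bullet> (A *v z) - \<mu> * (z \<bullet> z))" for t
  proof -
    have "v \<bullet> (A *v z) = z \<bullet> (A *v v)"
      using symmetric_matrix_inner[OF sym, of v z] by (simp add: inner_commute)
    then have "(v + t *\<^sub>R z) \<bullet> (A *v (v + t *\<^sub>R z)) =
        \<mu> + 2 * t * (z \<bullet> z + \<mu> * (v \<bullet> z)) + t\<^sup>2 * (z \<bullet> (A *v z))"
      by (simp add: matrix_vector_right_distrib matrix_vector_mult_scaleR inner_add_left
          inner_add_right zv \<mu>_def[symmetric] power2_eq_square algebra_simps)
    moreover have "(norm (v + t *\<^sub>R z))\<^sup>2 = 1 + 2 * t * (v \<bullet> z) + t\<^sup>2 * (z \<bullet> z)"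
      unfolding power2_norm_eq_inner
      by (simp add: inner_add_left inner_add_right nv inner_commute[of z v]
          power2_eq_square algebra_simps)
    moreover have "\<mu> * (norm (v + t *\<^sub>R z))\<^sup>2 \<le> (v + t *\<^sub>R z) \<bullet> (A *v (v + t *\<^sub>R z))"
      using uv uz by (intro bound) (simp add: inner_add_right)
    ultimately show ?thesis
      by (simp add: algebra_simps)
  qed
  then have "z \<bullet> z = 0"
    by (rule nonneg_quadratic_imp_linear_zero)
  then have "A *v v = \<mu> *\<^sub>R v"
    by (simp add: z_def)
  with uv nv bound show ?thesis
    by (intro that[of v \<mu>]) auto
qed

section \<open>The codegree Laplacian and its kernel\<close>

lemma codegree_commute: "codegree H u v = codegree H v u"
  by (simp add: codegree_def conj_commute)

text \<open>Double counting of triples of an edge and an ordered pair of its vertices. The diagonal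
  is included, where \<open>codegree H u u\<close> is the degree of \<open>u\<close>.\<close>

lemma sum_codegree:
  fixes f :: "'v::finite \<Rightarrow> 'v \<Rightarrow> real"
  shows "(\<Sum>u\<in>UNIV. \<Sum>v\<in>UNIV. real (codegree H u v) * f u v) = (\<Sum>e\<in>#H. \<Sum>u\<in>e. \<Sum>v\<in>e. f u v)"
proof (induction H)
  case (add e H)
  have "real (codegree (add_mset e H) u v) * f u v =
      real (codegree H u v) * f u v + (if u \<in> e then if v \<in> e then f u v else 0 else 0)" for u v
    by (simp add: codegree_def algebra_simps)
  moreover have "(\<Sum>u\<in>UNIV. \<Sum>v\<in>UNIV. if u \<in> e then if v \<in> e then f u v else 0 else 0) =
      (\<Sum>u\<in>e. \<Sum>v\<in>e. f u v)"
  proof -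
    have "(\<Sum>v\<in>UNIV. if u \<in> e then if v \<in> e then f u v else 0 else 0) =
        (if u \<in> e then \<Sum>v\<in>e. f u v else 0)" for u
      by (simp add: sum.If_cases)
    then show ?thesis
      by (simp add: sum.If_cases)
  qed
  ultimately show ?case
    using add by (simp add: sum.distrib)
qed (simp add: codegree_def)

text \<open>The term \<open>v = u\<close> is zero, so the sum can run over all vertices.\<close>

lemma codegree_laplacian_mult:
  "(codegree_laplacian H *v x) $ u = (\<Sum>v\<in>UNIV. real (codegree H u v) * (x $ u - x $ v))"
proof -
  have "(codegree_laplacian H *v x) $ u =
      (\<Sum>v\<in>UNIV - {u}. real (codegree H u v)) * x $ u + (\<Sum>v\<in>UNIV - {u}. - real (codegree H u v) * x $ v)"
    by (simp add: matrix_vector_mult_def codegree_laplacian_def sum.remove[of UNIV u])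
  also have "\<dots> = (\<Sum>v\<in>UNIV - {u}. real (codegree H u v) * (x $ u - x $ v))"
    by (simp add: sum_distrib_right sum_subtractf sum_negf right_diff_distrib)
  also have "\<dots> = (\<Sum>v\<in>UNIV. real (codegree H u v) * (x $ u - x $ v))"
    by (simp add: sum.remove[of UNIV u])
  finally show ?thesis .
qed

lemma transpose_codegree_laplacian: "transpose (codegree_laplacian H) = codegree_laplacian H"
  by (simp add: vec_eq_iff transpose_def codegree_laplacian_def codegree_commute)

lemma codegree_laplacian_mult_one: "codegree_laplacian H *v 1 = 0"
  by (simp add: vec_eq_iff codegree_laplacian_mult)

text \<open>Symmetrisation: the form is added to its copy with \<open>u\<close> and \<open>v\<close>
  exchanged. The factor 2 reflects that ordered pairs are summed.\<close>

lemma codegree_laplacian_quadratic_form: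
  "2 * (x \<bullet> (codegree_laplacian H *v x)) =
    (\<Sum>u\<in>UNIV. \<Sum>v\<in>UNIV. real (codegree H u v) * (x $ u - x $ v)\<^sup>2)"
proof -
  define s where "s = (\<Sum>u\<in>UNIV. \<Sum>v\<in>UNIV. real (codegree H u v) * (x $ u * (x $ u - x $ v)))"
  have s: "x \<bullet> (codegree_laplacian H *v x) = s"
    by (simp add: inner_vec_def codegree_laplacian_mult sum_distrib_left s_def mult.left_commute)
  have "s = (\<Sum>u\<in>UNIV. \<Sum>v\<in>UNIV. real (codegree H u v) * (x $ v * (x $ v - x $ u)))"
    unfolding s_def by (subst sum.swap) (simp add: codegree_commute)
  then have "s + s = (\<Sum>u\<in>UNIV. \<Sum>v\<in>UNIV. real (codegree H u v) * (x $ u * (x $ u - x $ v))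
      + real (codegree H u v) * (x $ v * (x $ v - x $ u)))"
    unfolding sum.distrib by (simp add: s_def)
  also have "\<dots> = (\<Sum>u\<in>UNIV. \<Sum>v\<in>UNIV. real (codegree H u v) * (x $ u - x $ v)\<^sup>2)"
    by (intro sum.cong refl) (simp add: power2_eq_square algebra_simps)
  finally show ?thesis
    by (simp add: s)
qed

lemma codegree_laplacian_psd: "0 \<le> x \<bullet> (codegree_laplacian H *v x)"
proof -
  have "0 \<le> 2 * (x \<bullet> (codegree_laplacian H *v x))"
    unfolding codegree_laplacian_quadratic_form by (intro sum_nonneg) simp
  then show ?thesis
    by simp
qed

text \<open>If \<open>x\<close> took two values, some edge would leave the level set of
  \<open>x $ u\<close>, and a pair in it would contribute a positive term to the quadratic
  form.\<close>

lemma connected_codegree_laplacian_kernel: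
  assumes "connected_hypergraph H" and "x \<bullet> (codegree_laplacian H *v x) = 0"
  shows "x $ u = x $ v"
proof (rule ccontr)
  assume "x $ u \<noteq> x $ v"
  define S where "S = {w. x $ w = x $ u}"
  have "u \<in> S" "v \<notin> S"
    using \<open>x $ u \<noteq> x $ v\<close> by (auto simp: S_def)
  then have "S \<noteq> {} \<and> S \<subset> UNIV"
    by blast
  with assms(1) obtain e where "e \<in># H" "e \<inter> S \<noteq> {}" "e \<inter> (UNIV - S) \<noteq> {}"
    unfolding connected_hypergraph_def by meson
  then obtain a b where e: "e \<in># H" "a \<in> e" "b \<in> e" and ab: "x $ a \<noteq> x $ b"
    unfolding S_def
    by (metis (mono_tags, lifting) DiffD2 IntE ex_in_conv mem_Collect_eq)
  have "e \<in># {#e \<in># H. a \<in> e \<and> b \<in> e#}"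
    using e by simp
  then have "codegree H a b > 0"
    unfolding codegree_def by (auto simp: nonempty_has_size[symmetric])
  moreover have "(\<Sum>u\<in>UNIV. \<Sum>v\<in>UNIV. real (codegree H u v) * (x $ u - x $ v)\<^sup>2) = 0"
    unfolding codegree_laplacian_quadratic_form[symmetric] assms(2) by simp
  then have "(\<Sum>v\<in>UNIV. real (codegree H a v) * (x $ a - x $ v)\<^sup>2) = 0"
    by (subst (asm) sum_nonneg_eq_0_iff) (auto intro!: sum_nonneg)
  then have "real (codegree H a b) * (x $ a - x $ b)\<^sup>2 = 0"
    by (subst (asm) sum_nonneg_eq_0_iff) auto
  ultimately show False
    using ab by simp
qed


section \<open>Positivity and the Rayleigh bound for \<open>\<lambda>\<^sub>1\<close>\<close>

text \<open>Splitting off one factor \<open>X\<close> leaves a polynomial \<open>q\<close> with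
  positive roots only, so the sorted eigenvalue list is 0 followed by the roots of
  \<open>q\<close>.\<close>

lemma laplacian_eigenvalue_one:
  fixes H :: "'v::finite hypergraph"
  assumes conn: "connected_hypergraph H" and card: "CARD('v) \<ge> 2"
  shows laplacian_eigenvalue_one_pos: "0 < laplacian_eigenvalue H 1"
    and laplacian_eigenvalue_one_rayleigh: "\<And>y :: real ^ 'v. 1 \<bullet> y = 0 \<Longrightarrow>
      laplacian_eigenvalue H 1 * (norm y)\<^sup>2 \<le> y \<bullet> (codegree_laplacian H *v y)"
proof -
  define L where "L = codegree_laplacian H"
  have L1: "1 v* L = 0"
    using codegree_laplacian_mult_one[of H]
    by (metis L_def transpose_codegree_laplacian transpose_matrix_vector)
  have kernel: "y = 0" if "y \<bullet> (L *v y) = 0" "1 \<bullet> y = 0" for y :: "real ^ 'v"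
  proof -
    have const: "y $ u = y $ v" for u v
      using connected_codegree_laplacian_kernel[OF conn] that(1) by (simp add: L_def)
    have "0 = (\<Sum>v\<in>UNIV. y $ v)"
      using that(2) by (simp add: inner_vec_def)
    also have "\<dots> = (\<Sum>v\<in>(UNIV :: 'v set). y $ u)" for u
      using const by (intro sum.cong) auto
    finally show ?thesis
      by (simp add: vec_eq_iff)
  qed
  \<comment> \<open>\<open>undefined\<close> stands for an arbitrary fixed vertex, whose row is
    replaced by ones.\<close>
  obtain q where q: "charpoly L = [:0, 1:] * q"
    and q0: "poly q 0 = det (\<chi> i. if i = undefined then 1 else row i (- L))"
    using charpoly_zero_column_sums[OF L1] by blast
  have "poly q 0 \<noteq> 0"
  proof -
    define M :: "real ^ 'v ^ 'v" where "M = (\<chi> i. if i = undefined then 1 else row i (- L))"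
    \<comment> \<open>The special row says that \<open>y\<close> is orthogonal to the constants, the
      others that \<open>L *v y\<close> vanishes off one vertex. Zero column sums settle that
      vertex, and connectedness then forces \<open>y = 0\<close>.\<close>
    have "y = 0" if "M *v y = 0" for y
    proof -
      have M: "(M *v y) $ i = (if i = undefined then 1 \<bullet> y else - (L *v y) $ i)" for i
        by (simp add: M_def matrix_vector_mult_def row_def inner_vec_def sum_negf)
      then have sum: "1 \<bullet> y = 0" and off: "i \<noteq> undefined \<Longrightarrow> (L *v y) $ i = 0" for i
        using that by (metis zero_index, metis neg_equal_0_iff_equal zero_index)
      have "1 \<bullet> (L *v y) = 0"
        by (simp add: dot_lmul_matrix[symmetric] L1)
      then have "(\<Sum>i\<in>UNIV. (L *v y) $ i) = 0"
        by (simp add: inner_vec_def)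
      then have "(L *v y) $ undefined = 0"
        using off by (simp add: sum.remove[of UNIV undefined])
      then have "L *v y = 0"
        using off by (metis vec_eq_iff zero_index)
      then show ?thesis
        using sum by (intro kernel) auto
    qed
    then show ?thesis
      using invertible_det_nz[of M] invertible_left_inverse[of M] matrix_left_invertible_ker[of M]
      unfolding q0 M_def[symmetric] by blast
  qed
  then have "q \<noteq> 0"
    by auto
  \<comment> \<open>Semidefiniteness makes roots non-negative, and
    \<open>poly q 0 \<noteq> 0\<close> excludes 0.\<close>
  have root_pos: "a > 0" if "poly q a = 0" for a
  proof -
    have "poly (charpoly L) a = 0"
      using that by (simp add: q)
    then obtain v where "v \<noteq> 0" "L *v v = a *\<^sub>R v"
      unfolding poly_charpoly_eq_0_iff by blast
    then have "0 \<le> a * (v \<bullet> v)" "v \<bullet> v > 0"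
      using codegree_laplacian_psd[of v H] by (simp_all add: L_def)
    moreover have "a \<noteq> 0"
      using that \<open>poly q 0 \<noteq> 0\<close> by auto
    ultimately show ?thesis
      by (simp add: zero_le_mult_iff less_le)
  qed
  \<comment> \<open>Two distinct vertices give a nonzero vector orthogonal to the constants.\<close>
  obtain i j :: 'v where "i \<noteq> j"
    using card ex_card[of 2 "UNIV :: 'v set"] by (auto simp: card_2_iff)
  then have w: "axis i 1 - axis j 1 \<noteq> (0 :: real ^ 'v)" "1 \<bullet> (axis i 1 - axis j 1 :: real ^ 'v) = 0"
    by (simp_all add: axis_eq_axis inner_diff_right inner_axis)
  obtain v \<mu> where v: "v \<noteq> 0" "1 \<bullet> v = 0" "L *v v = \<mu> *\<^sub>R v"
    and rayleigh: "\<And>y. 1 \<bullet> y = 0 \<Longrightarrow> \<mu> * (norm y)\<^sup>2 \<le> y \<bullet> (L *v y)"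
    using rayleigh_minimum_orthogonal[OF transpose_codegree_laplacian codegree_laplacian_mult_one w, of H]
    unfolding L_def by metis
  have "\<mu> \<noteq> 0"
    using kernel[of v] v by auto
  have "poly (charpoly L) \<mu> = 0"
    using v poly_charpoly_eq_0_iff by blast
  with \<open>\<mu> \<noteq> 0\<close> have "poly q \<mu> = 0"
    by (simp add: q)
  define zs where "zs = sorted_list_of_multiset (proots q)"
  have set_zs: "set zs = {a. poly q a = 0}" and "sorted zs"
    using \<open>q \<noteq> 0\<close> by (simp_all add: zs_def)
  have "proots (charpoly L) = add_mset 0 (proots q)"
    using \<open>q \<noteq> 0\<close> by (simp add: q proots_mult del: mult_pCons_left)
  then have "eigenvalue_list L = insort 0 zs"
    by (simp add: eigenvalue_list_def zs_def)
  also have "\<dots> = 0 # zs"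
    using root_pos set_zs by (intro insort_is_Cons) (auto intro: less_imp_le)
  finally have list: "eigenvalue_list L = 0 # zs" .
  have "\<mu> \<in> set zs"
    using \<open>poly q \<mu> = 0\<close> set_zs by simp
  then obtain z zs' where zs: "zs = z # zs'"
    by (cases zs) auto
  \<comment> \<open>Index 1 of \<open>0 # zs\<close> is the head of \<open>zs\<close>, the least
    root of \<open>q\<close>; as \<open>\<mu>\<close> is also a root, the Rayleigh bound for
    \<open>\<mu>\<close> passes to it.\<close>
  have eq: "laplacian_eigenvalue H 1 = z"
    using list by (simp add: laplacian_eigenvalue_def L_def zs)
  show "0 < laplacian_eigenvalue H 1"
    unfolding eq using zs set_zs by (intro root_pos) auto
  fix y :: "real ^ 'v"
  assume "1 \<bullet> y = 0"
  have "z \<le> \<mu>"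
    using \<open>\<mu> \<in> set zs\<close> \<open>sorted zs\<close> by (auto simp: zs)
  then have "z * (norm y)\<^sup>2 \<le> \<mu> * (norm y)\<^sup>2"
    by (simp add: mult_right_mono)
  then show "laplacian_eigenvalue H 1 * (norm y)\<^sup>2 \<le> y \<bullet> (codegree_laplacian H *v y)"
    unfolding eq using rayleigh[OF \<open>1 \<bullet> y = 0\<close>] by (simp add: L_def)
qed

section \<open>A single averaging step\<close>

lemma sum_average_edge: "(\<Sum>u\<in>UNIV. average_edge e x $ u) = (\<Sum>u\<in>UNIV. x $ u)"
proof -
  have "(\<Sum>u\<in>UNIV. average_edge e x $ u) =
      (\<Sum>u\<in>e. (\<Sum>v\<in>e. x $ v) / real (card e)) + (\<Sum>u\<in>- e. x $ u)"
    by (simp add: average_edge_def sum.If_cases)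
  also have "\<dots> = (\<Sum>v\<in>e. x $ v) + (\<Sum>u\<in>- e. x $ u)"
    by (cases "e = {}") auto
  also have "\<dots> = (\<Sum>u\<in>UNIV. x $ u)"
    using sum.union_disjoint[of e "- e" "\<lambda>u. x $ u"] by simp
  finally show ?thesis .
qed

lemma average_vector_average_edge: "average_vector (average_edge e x) = average_vector x"
  by (simp add: average_vector_def sum_average_edge)

text \<open>Averaging is linear and fixes constant vectors, so everything can be computed for the
  centred vector.\<close>

lemma average_edge_diff_average_vector:
  "average_edge e x - average_vector x = average_edge e (x - average_vector x)"
proof -
  have "(\<Sum>v\<in>e. x $ v) / real (card e) - a = (\<Sum>v\<in>e. x $ v - a) / real (card e)" if "u \<in> e" for u a
  proof -
    have "card e \<noteq> 0"
      using that by auto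
    then show ?thesis
      by (simp add: sum_subtractf diff_divide_distrib)
  qed
  then show ?thesis
    by (simp add: vec_eq_iff average_edge_def average_vector_def)
qed

text \<open>The variance identity on \<open>e\<close>: the loss is the sum of squares minus the
  squared sum over \<open>card e\<close>. Clearing the denominator lets the identity cover the empty
  edge.\<close>

lemma norm_average_edge:
  "2 * real (card e) * ((norm z)\<^sup>2 - (norm (average_edge e z))\<^sup>2) =
    (\<Sum>u\<in>e. \<Sum>v\<in>e. (z $ u - z $ v)\<^sup>2)"
proof (cases "e = {}")
  case False
  define s where "s = (\<Sum>u\<in>e. z $ u)"
  define Q where "Q = (\<Sum>u\<in>e. (z $ u)\<^sup>2)"
  have card: "real (card e) > 0"
    using False by (simp add: card_gt_0_iff)
  have norm2: "(norm y)\<^sup>2 = (\<Sum>u\<in>e. (y $ u)\<^sup>2) + (\<Sum>u\<in>- e. (y $ u)\<^sup>2)" for y :: "real ^ 'a"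
    using sum.union_disjoint[of e "- e" "\<lambda>u. (y $ u)\<^sup>2"]
    unfolding power2_norm_eq_inner inner_vec_def by (simp add: power2_eq_square)
  have diff: "(norm z)\<^sup>2 - (norm (average_edge e z))\<^sup>2 = Q - s\<^sup>2 / real (card e)"
    unfolding norm2 using card
    by (simp add: average_edge_def s_def[symmetric] Q_def power2_eq_square)
  have pairs: "(\<Sum>u\<in>e. \<Sum>v\<in>e. (z $ u - z $ v)\<^sup>2) = 2 * real (card e) * Q - 2 * s\<^sup>2"
  proof -
    have "(\<Sum>u\<in>e. \<Sum>v\<in>e. (z $ u - z $ v)\<^sup>2) =
        (\<Sum>u\<in>e. \<Sum>v\<in>e. (z $ u)\<^sup>2 + (z $ v)\<^sup>2 - 2 * (z $ u * z $ v))"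
      by (simp add: power2_diff mult.assoc)
    also have "\<dots> = 2 * real (card e) * Q - 2 * (\<Sum>u\<in>e. \<Sum>v\<in>e. z $ u * z $ v)"
      by (simp add: sum.distrib sum_subtractf Q_def sum_distrib_left mult.assoc)
    also have "(\<Sum>u\<in>e. \<Sum>v\<in>e. z $ u * z $ v) = s\<^sup>2"
      by (simp add: s_def power2_eq_square sum_product)
    finally show ?thesis .
  qed
  show ?thesis
    unfolding diff pairs using card False by (simp add: field_simps)
qed simp

text \<open>Links sums over edges with multiplicity to expectations under
  \<open>pmf_of_multiset\<close>, whose weights are proportional to \<open>count\<close>.\<close>

lemma sum_mset_eq_sum_count: "(\<Sum>e\<in>#H. f e) = (\<Sum>e\<in>set_mset H. f e * real (count H e))"
proof (induction H)
  case (add e H)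
  \<comment> \<open>If \<open>e\<close> is new to \<open>H\<close>, its extra term has count
    0.\<close>
  have "(\<Sum>a\<in>set_mset (add_mset e H). f a * real (count H a)) = (\<Sum>a\<in>set_mset H. f a * real (count H a))"
    by (intro sum.mono_neutral_right) (auto simp: not_in_iff)
  moreover have "(\<Sum>a\<in>set_mset (add_mset e H). f a * real (count (add_mset e H) a)) =
      (\<Sum>a\<in>set_mset (add_mset e H). f a * real (count H a) + (if a = e then f a else 0))"
    by (intro sum.cong) (auto simp: algebra_simps)
  ultimately show ?case
    using add by (simp add: sum.distrib del: set_mset_add_mset_insert) simp
qed simp

lemma expectation_averaging_step:
  fixes f :: "real ^ 'v::finite \<Rightarrow> real"
  assumes "H \<noteq> {#}"
  shows "measure_pmf.expectation (averaging_step H x) f = (\<Sum>e\<in>#H. f (average_edge e x)) / real (size H)"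
proof -
  have "measure_pmf.expectation (averaging_step H x) f =
      measure_pmf.expectation (pmf_of_multiset H) (\<lambda>e. f (average_edge e x))"
    by (simp add: averaging_step_def)
  also have "\<dots> = (\<Sum>e\<in>set_mset H. f (average_edge e x) * pmf (pmf_of_multiset H) e)"
    using assms by (intro integral_measure_pmf_real) auto
  finally have "measure_pmf.expectation (averaging_step H x) f =
      (\<Sum>e\<in>set_mset H. f (average_edge e x) * (real (count H e) / real (size H)))"
    using assms by simp
  then show ?thesis
    by (simp add: sum_mset_eq_sum_count sum_divide_distrib)
qed

lemma averaging_step_contraction:
  fixes H :: "'v::finite hypergraph"
  assumes conn: "connected_hypergraph H" and card: "CARD('v) \<ge> 2"
    and "H \<noteq> {#}" and edges: "\<And>e. e \<in># H \<Longrightarrow> card e \<le> r" and "r > 0"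
  shows "measure_pmf.expectation (averaging_step H x) (\<lambda>y. (norm (y - average_vector x))\<^sup>2)
    \<le> (1 - laplacian_eigenvalue H 1 / (real r * real (size H))) * (norm (x - average_vector x))\<^sup>2"
proof -
  define z where "z = x - average_vector x"
  define D where "D e = (\<Sum>u\<in>e. \<Sum>v\<in>e. (z $ u - z $ v)\<^sup>2)" for e
  have "1 \<bullet> z = 0"
    by (simp add: z_def average_vector_def inner_vec_def sum_subtractf)
  have size: "real (size H) > 0"
    using \<open>H \<noteq> {#}\<close> by (simp add: nonempty_has_size[symmetric])
  have "(norm (average_edge e z))\<^sup>2 \<le> (norm z)\<^sup>2 - 1 / (2 * real r) * D e" if "e \<in># H" for e
  proof (cases "e = {}")
    case False
    have "D e \<ge> 0"
      unfolding D_def by (intro sum_nonneg) simp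
    have c: "real (card e) > 0"
      using False by (simp add: card_gt_0_iff)
    \<comment> \<open>Here the upper bound on edge sizes enters: replacing \<open>card e\<close> by
      \<open>r\<close> only lowers the guaranteed decrease.\<close>
    have "1 / (2 * real r) * D e \<le> 1 / (2 * real (card e)) * D e"
      using c \<open>D e \<ge> 0\<close> edges[OF that] by (intro mult_right_mono divide_left_mono) auto
    also have "\<dots> = (norm z)\<^sup>2 - (norm (average_edge e z))\<^sup>2"
      unfolding D_def norm_average_edge[symmetric] using c False by simp
    finally show ?thesis
      by simp
  qed (simp add: D_def average_edge_def)
  then have "(\<Sum>e\<in>#H. (norm (average_edge e z))\<^sup>2) \<le> (\<Sum>e\<in>#H. (norm z)\<^sup>2 - 1 / (2 * real r) * D e)"
    by (rule sum_mset_mono)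
  also have "\<dots> = real (size H) * (norm z)\<^sup>2 - 1 / (2 * real r) * (\<Sum>e\<in>#H. D e)"
    by (induction H) (simp_all add: algebra_simps add_divide_distrib)
  also have "(\<Sum>e\<in>#H. D e) = 2 * (z \<bullet> (codegree_laplacian H *v z))"
    unfolding D_def codegree_laplacian_quadratic_form sum_codegree ..
  also have "real (size H) * (norm z)\<^sup>2 - 1 / (2 * real r) * (2 * (z \<bullet> (codegree_laplacian H *v z)))
      \<le> real (size H) * (norm z)\<^sup>2 - laplacian_eigenvalue H 1 * (norm z)\<^sup>2 / real r"
    using laplacian_eigenvalue_one_rayleigh[OF conn card \<open>1 \<bullet> z = 0\<close>] \<open>r > 0\<close>
    by (simp add: divide_right_mono)
  also have "\<dots> = (1 - laplacian_eigenvalue H 1 / (real r * real (size H))) * (norm z)\<^sup>2 * real (size H)"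
    using \<open>H \<noteq> {#}\<close> \<open>r > 0\<close> by (simp add: field_simps)
  finally show ?thesis
    using size unfolding expectation_averaging_step[OF \<open>H \<noteq> {#}\<close>]
    by (simp add: average_edge_diff_average_vector z_def[symmetric] pos_divide_le_eq)
qed

section \<open>Iterating the step\<close>

lemma finite_set_pmf_averaging_step: "H \<noteq> {#} \<Longrightarrow> finite (set_pmf (averaging_step H x))"
  by (simp add: averaging_step_def)

lemma finite_set_pmf_averaging_process: "H \<noteq> {#} \<Longrightarrow> finite (set_pmf (averaging_process H t x))"
  by (induction t) (simp_all add: finite_set_pmf_averaging_step)

lemma average_vector_averaging_process:
  "y \<in> set_pmf (averaging_process H t x) \<Longrightarrow> average_vector y = average_vector x"
proof (induction t arbitrary: y)
  case (Suc t)
  then show ?case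
    by (auto simp: averaging_step_def average_vector_average_edge)
qed simp

text \<open>Conditioning on the state after \<open>t\<close> steps gives one factor \<open>k\<close>
  per step.\<close>

lemma averaging_process_decay:
  fixes H :: "'v::finite hypergraph"
  assumes "H \<noteq> {#}" and "k \<ge> 0"
    and step: "\<And>y. measure_pmf.expectation (averaging_step H y) (\<lambda>z. (norm (z - average_vector y))\<^sup>2)
      \<le> k * (norm (y - average_vector y))\<^sup>2"
  shows "measure_pmf.expectation (averaging_process H t x) (\<lambda>y. (norm (y - average_vector x))\<^sup>2)
    \<le> k ^ t * (norm (x - average_vector x))\<^sup>2"
proof (induction t)
  case (Suc t)
  let ?P = "averaging_process H t x"
  let ?V = "\<lambda>y. (norm (y - average_vector x))\<^sup>2"
  have fin: "finite (set_pmf ?P)"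
    using assms(1) by (rule finite_set_pmf_averaging_process)
  have "measure_pmf.expectation (averaging_process H (Suc t) x) ?V =
      (\<Sum>y\<in>set_pmf ?P. pmf ?P y * measure_pmf.expectation (averaging_step H y) ?V)"
    using fin assms(1) by (simp add: pmf_expectation_bind[of "set_pmf ?P"] finite_set_pmf_averaging_step)
  \<comment> \<open>\<open>step\<close> centres at the mean of \<open>y\<close>, which on the
    support is the mean of \<open>x\<close>.\<close>
  also have "\<dots> \<le> (\<Sum>y\<in>set_pmf ?P. pmf ?P y * (k * ?V y))"
    using step average_vector_averaging_process[of _ H t x]
    by (intro sum_mono mult_left_mono) (metis, simp)
  also have "\<dots> = k * measure_pmf.expectation ?P ?V"
    using fin by (simp add: integral_measure_pmf_real[of "set_pmf ?P"] sum_distrib_left ac_simps)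
  also have "\<dots> \<le> k * (k ^ t * ?V x)"
    using Suc \<open>k \<ge> 0\<close> by (intro mult_left_mono)
  finally show ?case
    by (simp add: ac_simps)
qed simp

section \<open>Comparison of norms and of moments\<close>

text \<open>Jensen's inequality for the square, in the form that a variance is non-negative.\<close>

lemma expectation_le_sqrt_expectation_square:
  fixes f :: "'a \<Rightarrow> real"
  assumes "finite (set_pmf p)"
  shows "measure_pmf.expectation p f \<le> sqrt (measure_pmf.expectation p (\<lambda>y. (f y)\<^sup>2))"
proof -
  have "0 \<le> measure_pmf.variance p f"
    by (rule measure_pmf.variance_positive)
  also have "\<dots> = measure_pmf.expectation p (\<lambda>y. (f y)\<^sup>2) - (measure_pmf.expectation p f)\<^sup>2"
    using assms by (intro measure_pmf.variance_eq integrable_measure_pmf_finite)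
  finally show ?thesis
    by (intro real_le_rsqrt) simp
qed

text \<open>Cauchy--Schwarz against the all-ones vector; the factor here produces the
  \<open>log n\<close> in the second time bound.\<close>

lemma l1_norm_le_norm: "l1_norm x \<le> sqrt (real CARD('v)) * norm x"
  for x :: "real ^ 'v::finite"
proof -
  have "(l1_norm x)\<^sup>2 \<le> (\<Sum>u\<in>UNIV. \<bar>x $ u\<bar>\<^sup>2) * real CARD('v)"
    unfolding l1_norm_def by (rule sum_squared_le_sum_of_squares)
  also have "\<dots> = (sqrt (real CARD('v)) * norm x)\<^sup>2"
    unfolding power_mult_distrib power2_norm_eq_inner inner_vec_def by (simp add: power2_eq_square)
  finally show ?thesis
    by (rule power2_le_imp_le) simp
qed

section \<open>Degenerate cases and the mixing bounds\<close>

lemma connected_hypergraph_has_edge: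
  fixes H :: "'v::finite hypergraph"
  assumes "connected_hypergraph H" and "CARD('v) \<ge> 2"
  obtains e where "e \<in># H" and "e \<noteq> {}"
proof -
  fix v :: 'v
  have "{v} \<noteq> UNIV"
    using assms(2) by (metis card_1_singleton_iff One_nat_def numeral_le_one_iff semiring_norm(69))
  then obtain e where "e \<in># H" "e \<inter> {v} \<noteq> {}"
    using assms(1) unfolding connected_hypergraph_def by (metis psubset_eq subset_UNIV insert_not_empty)
  then show thesis
    using that by blast
qed

lemma average_vector_single_vertex:
  fixes x :: "real ^ 'v::finite"
  assumes "CARD('v) = 1"
  shows "average_vector x = x"
proof -
  obtain a :: 'v where a: "UNIV = {a}"
    using assms by (auto simp: card_1_singleton_iff)
  have "average_vector x $ u = x $ u" for u
  proof -
    have "u = a"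
      using a by blast
    then show ?thesis
      by (simp add: average_vector_def a)
  qed
  then show ?thesis
    by (simp add: vec_eq_iff)
qed

theorem corollary1p2:
  fixes H :: "'v::finite hypergraph" and r :: nat and c :: real and x :: "real ^ 'v"
  assumes "connected_hypergraph H"
    and "\<And>e. e \<in># H \<Longrightarrow> card e \<le> r"
  shows "(\<forall>t::nat. real t \<ge> 2 * c * (real r * real (size H) / laplacian_eigenvalue H 1) \<longrightarrow>
            measure_pmf.expectation (averaging_process H t x) (\<lambda>y. norm (y - average_vector x))
              \<le> exp (- c) * norm (x - average_vector x))
       \<and> (\<forall>t::nat. real t \<ge> (ln (real CARD('v)) + 2 * c) *
                              (real r * real (size H) / laplacian_eigenvalue H 1) \<longrightarrow>
            measure_pmf.expectation (averaging_process H t x) (\<lambda>y. l1_norm (y - average_vector x))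
              \<le> exp (- c) * norm (x - average_vector x))"
proof (cases "CARD('v) \<ge> 2")
  case False
  \<comment> \<open>With one vertex, \<open>\<lambda>\<^sub>1\<close> lies outside the meaningful
    range and \<open>H\<close> may be empty. Every vector equals its average, so both sides of both
    bounds are 0 for every \<open>t\<close>.\<close>
  then have "CARD('v) = 1"
    using zero_less_card_finite[where 'a = 'v] by linarith
  note average_vector_single_vertex[OF this]
  then have "y = average_vector x" if "y \<in> set_pmf (averaging_process H t x)" for t y
    using average_vector_averaging_process[OF that] by metis
  then have "measure_pmf.expectation (averaging_process H t x) f =
      measure_pmf.expectation (averaging_process H t x) (\<lambda>_. f (average_vector x))" for t and f :: "_ \<Rightarrow> real"
    by (intro integral_cong_AE) (auto simp: AE_measure_pmf_iff)
  then have "measure_pmf.expectation (averaging_process H t x) f = f (average_vector x)" for t and f :: "_ \<Rightarrow> real"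
    by simp
  then show ?thesis
    by (simp add: l1_norm_def)
next
  case True
  obtain e where e: "e \<in># H" "e \<noteq> {}"
    using connected_hypergraph_has_edge[OF assms(1) True] .
  then have "H \<noteq> {#}"
    by auto
  have "card e > 0"
    using e by (simp add: card_gt_0_iff)
  with assms(2)[OF e(1)] have "r > 0"
    by linarith
  define \<rho> where "\<rho> = laplacian_eigenvalue H 1 / (real r * real (size H))"
  define N where "N = norm (x - average_vector x)"
  have "\<rho> > 0"
    using laplacian_eigenvalue_one_pos[OF assms(1) True] \<open>r > 0\<close> \<open>H \<noteq> {#}\<close>
    by (simp add: \<rho>_def nonempty_has_size[symmetric])
  \<comment> \<open>Both time thresholds become lower bounds on
    \<open>\<rho> * real t\<close>.\<close>
  have time: "b * (real r * real (size H) / laplacian_eigenvalue H 1) \<le> real t \<longleftrightarrow> b \<le> \<rho> * real t" for b t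
  proof -
    have "real r * real (size H) / laplacian_eigenvalue H 1 = 1 / \<rho>"
      by (simp add: \<rho>_def)
    then show ?thesis
      using \<open>\<rho> > 0\<close> by (simp add: pos_divide_le_eq mult.commute)
  qed
  have fin: "finite (set_pmf (averaging_process H t x))" for t
    using \<open>H \<noteq> {#}\<close> by (rule finite_set_pmf_averaging_process)
  have l2: "measure_pmf.expectation (averaging_process H t x) (\<lambda>y. norm (y - average_vector x))
      \<le> exp (- \<rho> * real t / 2) * N" for t
  proof -
    have "measure_pmf.expectation (averaging_process H t x) (\<lambda>y. norm (y - average_vector x))
        \<le> sqrt (measure_pmf.expectation (averaging_process H t x) (\<lambda>y. (norm (y - average_vector x))\<^sup>2))"
      using fin by (rule expectation_le_sqrt_expectation_square)
    \<comment> \<open>The rate \<open>exp (- \<rho>)\<close> bounds \<open>1 - \<rho>\<close> from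
      above and is visibly non-negative, as the iteration requires.\<close>
    also have "\<dots> \<le> sqrt (exp (- \<rho>) ^ t * N\<^sup>2)"
      unfolding N_def
    proof (intro real_sqrt_le_mono averaging_process_decay)
      fix y :: "real ^ 'v"
      have "measure_pmf.expectation (averaging_step H y) (\<lambda>z. (norm (z - average_vector y))\<^sup>2)
          \<le> (1 - \<rho>) * (norm (y - average_vector y))\<^sup>2"
        unfolding \<rho>_def
        by (rule averaging_step_contraction[OF assms(1) True \<open>H \<noteq> {#}\<close> assms(2) \<open>r > 0\<close>])
      also have "\<dots> \<le> exp (- \<rho>) * (norm (y - average_vector y))\<^sup>2"
        using exp_ge_add_one_self[of "- \<rho>"] by (intro mult_right_mono) auto
      finally show "measure_pmf.expectation (averaging_step H y) (\<lambda>z. (norm (z - average_vector y))\<^sup>2)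
          \<le> exp (- \<rho>) * (norm (y - average_vector y))\<^sup>2" .
    qed (use \<open>H \<noteq> {#}\<close> in auto)
    also have "exp (- \<rho>) ^ t * N\<^sup>2 = (exp (- \<rho> * real t / 2) * N)\<^sup>2"
      unfolding power_mult_distrib exp_double[symmetric] exp_of_nat_mult[symmetric]
      by (simp add: mult.commute)
    finally show ?thesis
      by (simp add: N_def)
  qed
  have "measure_pmf.expectation (averaging_process H t x) (\<lambda>y. norm (y - average_vector x)) \<le> exp (- c) * N"
    if "2 * c \<le> \<rho> * real t" for t
  proof -
    have "exp (- \<rho> * real t / 2) * N \<le> exp (- c) * N"
      using that by (intro mult_right_mono) (auto simp: N_def)
    with l2 show ?thesis
      by (rule order_trans)
  qed
  moreover have "measure_pmf.expectation (averaging_process H t x) (\<lambda>y. l1_norm (y - average_vector x)) \<le> exp (- c) * N"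
    if "ln (real CARD('v)) + 2 * c \<le> \<rho> * real t" for t
  proof -
    have "measure_pmf.expectation (averaging_process H t x) (\<lambda>y. l1_norm (y - average_vector x))
        \<le> measure_pmf.expectation (averaging_process H t x)
            (\<lambda>y. sqrt (real CARD('v)) * norm (y - average_vector x))"
      by (intro integral_mono integrable_measure_pmf_finite fin l1_norm_le_norm)
    also have "\<dots> \<le> sqrt (real CARD('v)) * (exp (- \<rho> * real t / 2) * N)"
      using l2[of t] by (simp add: mult_left_mono)
    \<comment> \<open>In this form the factor is absorbed by the extra
      \<open>ln (real CARD('v))\<close> in the time threshold.\<close>
    also have "sqrt (real CARD('v)) = exp (ln (real CARD('v)) / 2)"
      by (simp add: ln_sqrt[symmetric])
    also have "exp (ln (real CARD('v)) / 2) * (exp (- \<rho> * real t / 2) * N) =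
        exp (ln (real CARD('v)) / 2 - \<rho> * real t / 2) * N"
      by (simp add: mult.assoc[symmetric] mult_exp_exp)
    also have "\<dots> \<le> exp (- c) * N"
      using that by (intro mult_right_mono) (auto simp: N_def field_simps)
    finally show ?thesis .
  qed
  ultimately show ?thesis
    unfolding time N_def by blast
qed

end
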